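(* If $\lambda_g>\frac{2}{\pi}$, then for $\mathbb{P}$-almost every $\omega\in W^{\mathbb{N}}$ the measure $\mu_\omega$ is absolutely continuous with respect to Lebesgue measure $\mathcal{L}$ on $\mathbb{R}$ with a continuous density. Consequently, $\Lambda_\omega$ has non-empty interior for $\mathbb{P}$-almost every $\omega$.
   Context: Let $W=[\lambda_{\min},\lambda_{\max}]\subset(0,1)$ be a closed interval with $\lambda_{\min}<\lambda_{\max}$. Let $\mathbb{P}$ be the product probability measure on $W^{\mathbb{N}}$ ($\mathbb{N}=\{1,2,\dots\}$) each of whose factors is the normalised Lebesgue (uniform) measure on $W$; thus the entries of $\omega=(\lambda_k)_{k\ge1}\in W^{\mathbb{N}}$ are i.i.d. uniform on $W$. Put $\lambda_g=\exp\mathbb{E}(\log\lambda_1)$. For $\omega=(\lambda_k)\in W^{\mathbb{N}}$, the random Bernoulli convolution $\mu_\omega$ is the infinite convolution of the measures $\frac12(\delta_0+\delta_{\lambda_1\lambda_2\cdots\lambda_k})$, $k\ge1$; equivalently, $\mu_\omega$ is the push-forward of the $(\frac12,\frac12)$-Bernoulli measure on $\{0,1\}^{\mathbb{N}}$ under the map $(a_j)\mapsto\sum_{j=1}^\infty a_j\prod_{k=1}^j\lambda_k$. The random self-similar set is $\Lambda_\omega=\left\{\sum_{j=1}^\infty a_j\prod_{k=1}^j\lambda_k : a_j\in\{0,1\}\ \forall j\in\mathbb{N}\right\}$, which is the support of $\mu_\omega$. *)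

theory Defs
  imports "HOL-Probability.Probability"
begin

text \<open>
  Sequences indexed by \<open>{1, 2, \<dots>}\<close> are represented as functions on \<^typ>\<open>nat\<close>
  with the index shifted by one: \<open>\<omega> k\<close> stands for \<open>\<lambda>\<close> with index \<open>k + 1\<close>, and
  \<open>a j\<close> for the digit with index \<open>j + 1\<close>.
\<close>

text \<open>The factor measure lives on \<open>W = {l..u}\<close> itself, so that the product has
  underlying space \<open>W\<close> to the power \<open>\<nat>\<close>; see \<open>space_ratio_measure\<close>.\<close>

definition ratio_measure :: "real \<Rightarrow> real \<Rightarrow> (nat \<Rightarrow> real) measure" where
  "ratio_measure l u =
     (\<Pi>\<^sub>M k\<in>UNIV. uniform_measure (restrict_space lborel {l..u}) {l..u})"

definition geometric_mean_ratio :: "real \<Rightarrow> real \<Rightarrow> real" where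
  "geometric_mean_ratio l u = exp (\<integral>\<omega>. ln (\<omega> 0) \<partial>ratio_measure l u)"

definition bernoulli_measure :: "(nat \<Rightarrow> real) measure" where
  "bernoulli_measure = (\<Pi>\<^sub>M j\<in>UNIV. uniform_count_measure {0, 1})"

definition coding_map :: "(nat \<Rightarrow> real) \<Rightarrow> (nat \<Rightarrow> real) \<Rightarrow> real" where
  "coding_map \<omega> a = (\<Sum>j. a j * (\<Prod>k\<le>j. \<omega> k))"

definition random_bernoulli_convolution :: "(nat \<Rightarrow> real) \<Rightarrow> real measure" where
  "random_bernoulli_convolution \<omega> = distr bernoulli_measure borel (coding_map \<omega>)"

definition random_self_similar_set :: "(nat \<Rightarrow> real) \<Rightarrow> real set" where
  "random_self_similar_set \<omega> = {coding_map \<omega> a |a. \<forall>j. a j \<in> {0, 1}}"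

definition has_continuous_density :: "real measure \<Rightarrow> bool" where
  "has_continuous_density M \<longleftrightarrow>
     (\<exists>f :: real \<Rightarrow> real. continuous_on UNIV f \<and> (\<forall>x. 0 \<le> f x) \<and>
        M = density lborel (\<lambda>x. ennreal (f x)))"

text \<open>The totalised library constants used above (\<^const>\<open>distr\<close>, \<^const>\<open>suminf\<close>) take
  junk values outside their intended domains; the following facts show that this
  does not occur here.\<close>

lemma space_ratio_measure: "space (ratio_measure l u) = (UNIV \<rightarrow>\<^sub>E {l..u})"
  by (simp add: ratio_measure_def space_PiM PiE_def space_restrict_space)

lemma prob_space_ratio_measure:
  assumes "l < u"
  shows "prob_space (ratio_measure l u)"
  unfolding ratio_measure_def
proof (intro prob_space_PiM prob_space_uniform_measure)
  have "emeasure (restrict_space lborel {l..u}) {l..u} = ennreal (u - l)"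
    using assms by (subst emeasure_restrict_space) auto
  then show "emeasure (restrict_space lborel {l..u}) {l..u} \<noteq> 0"
    and "emeasure (restrict_space lborel {l..u}) {l..u} \<noteq> \<infinity>"
    using assms by auto
qed

lemma space_bernoulli_measure: "space bernoulli_measure = (UNIV \<rightarrow>\<^sub>E {0, 1})"
  by (simp add: bernoulli_measure_def space_PiM space_uniform_count_measure)

lemma prob_space_bernoulli_measure: "prob_space bernoulli_measure"
  unfolding bernoulli_measure_def
  by (intro prob_space_PiM prob_space_uniform_count_measure) auto

lemma summable_coding_map:
  fixes \<omega> a :: "nat \<Rightarrow> real"
  assumes "0 < l" "u < 1" "\<And>k. \<omega> k \<in> {l..u}" "\<And>j. a j \<in> {0, 1}"
  shows "summable (\<lambda>j. a j * (\<Prod>k\<le>j. \<omega> k))"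
proof (rule summable_comparison_test'[where g = "\<lambda>j. u ^ Suc j" and N = 0])
  have u: "0 < u" using assms(1) assms(3)[of 0] by auto
  show "summable (\<lambda>j. u ^ Suc j)"
    using assms u by (subst summable_Suc_iff) (auto intro: summable_geometric)
  fix j :: nat
  have *: "0 \<le> (\<Prod>k\<le>j. \<omega> k)" "(\<Prod>k\<le>j. \<omega> k) \<le> u ^ Suc j"
  proof -
    show "0 \<le> (\<Prod>k\<le>j. \<omega> k)"
      using assms(1,3) by (intro prod_nonneg) (auto intro: order_trans less_imp_le)
    have "(\<Prod>k\<le>j. \<omega> k) \<le> (\<Prod>k\<le>j. u)"
      using assms(1,3) by (intro prod_mono) (auto intro: order_trans less_imp_le)
    then show "(\<Prod>k\<le>j. \<omega> k) \<le> u ^ Suc j" by simp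
  qed
  show "norm (a j * (\<Prod>k\<le>j. \<omega> k)) \<le> u ^ Suc j"
    using assms(4)[of j] * u by auto
qed

lemma measurable_coding_map: "coding_map \<omega> \<in> borel_measurable bernoulli_measure"
proof -
  have "(\<lambda>a. a j) \<in> borel_measurable bernoulli_measure" for j
    unfolding bernoulli_measure_def
    by (rule measurable_compose[OF measurable_component_singleton])
       (auto simp: measurable_def space_uniform_count_measure sets_uniform_count_measure)
  then show ?thesis
    unfolding coding_map_def[abs_def] by measurable
qed

end

theory Submission
  imports Defs
begin

text \<open>
  The proof shows that the characteristic function of \<open>\<mu>\<^sub>\<omega>\<close> is Lebesgue integrable for almost
  every \<open>\<omega>\<close>, and then inverts the Fourier transform.

  Write \<open>P n\<close> for the product of the first \<open>n\<close> ratios (\<open>contraction \<omega> n\<close>). The characteristic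
  function at \<open>\<xi>\<close> has modulus at most the product of \<open>\<bar>cos (\<xi> / 2 * P (k + 1))\<bar>\<close> over \<open>k < n\<close>,
  for every \<open>n\<close> (\<open>cmod_char_random_bernoulli_convolution_le\<close>). Conditionally on the first \<open>k\<close>
  ratios, the argument of factor \<open>k\<close> is uniform on an interval of length proportional to
  \<open>\<bar>\<xi>\<bar> * P k\<close>. As long as \<open>\<bar>\<xi>\<bar> * P k\<close> is large, the conditional mean of this factor is therefore at most
  some \<open>\<beta>\<close> slightly above \<open>2 / \<pi>\<close>, the mean of \<open>\<bar>cos\<bar>\<close> over a period (\<open>mean_abs_cos_le\<close>), and \<open>n\<close>
  such factors contribute at most \<open>\<beta> ^ n\<close> in expectation (\<open>nn_integral_guarded_cos_prod_le\<close>).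

  Choose \<open>2 / \<pi> < \<beta> < \<rho> < \<lambda>\<^sub>g\<close>. A Chernoff bound and the Borel-Cantelli lemma give
  \<open>\<rho> ^ n \<le> P n\<close> for all large \<open>n\<close>, almost surely (\<open>AE_eventually_power_le_contraction\<close>). So for
  \<open>\<bar>\<xi>\<bar>\<close> of order \<open>\<rho> ^ (- n)\<close> all of the first \<open>n\<close> factors are in the good range. The set of these \<open>\<xi>\<close>
  has measure of order \<open>\<rho> ^ (- n)\<close>, so its expected contribution to the integral of the
  characteristic function is of order \<open>(\<beta> / \<rho>) ^ n\<close>. This is summable exactly because
  \<open>\<beta> < \<rho>\<close>, which is where \<open>\<lambda>\<^sub>g > 2 / \<pi>\<close> enters
  (\<open>AE_integrable_char_random_bernoulli_convolution\<close>).

  An integrable characteristic function yields a continuous density by Levy's inversion formula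
  (\<open>has_continuous_density_of_integrable_char\<close>). Finally, \<open>\<Lambda>\<^sub>\<omega>\<close> is closed and carries \<open>\<mu>\<^sub>\<omega>\<close>, so it
  contains the non-empty open set on which the density is positive
  (\<open>interior_random_self_similar_set_nonempty\<close>).
\<close>

section \<open>Averages of the absolute cosine\<close>

text \<open>On the arch around \<open>n * \<pi>\<close> the cosine has constant sign, so \<open>\<bar>cos t\<bar>\<close> is the translate
  \<open>cos (t - n * \<pi>)\<close>, whose antiderivative is a sine.\<close>
lemma has_integral_abs_cos_arch:
  "((\<lambda>t. \<bar>cos t\<bar>) has_integral 2) {of_int n * pi - pi / 2..of_int n * pi + pi / 2}"
proof -
  let ?I = "{of_int n * pi - pi / 2..of_int n * pi + pi / 2}"
  have "((\<lambda>t. cos (t - of_int n * pi)) has_integral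
      sin ((of_int n * pi + pi / 2) - of_int n * pi) - sin ((of_int n * pi - pi / 2) - of_int n * pi)) ?I"
    by (intro fundamental_theorem_of_calculus)
       (auto intro!: derivative_eq_intros simp flip: has_real_derivative_iff_has_vector_derivative)
  moreover have "cos (t - of_int n * pi) = \<bar>cos t\<bar>" if "t \<in> ?I" for t
  proof -
    have "0 \<le> cos (t - of_int n * pi)"
      using that by (intro cos_ge_zero) auto
    moreover have "\<bar>cos (t - of_int n * pi)\<bar> = \<bar>cos t\<bar>"
      using cos_npi_int[of n] sin_npi_int[of n]
      by (simp add: cos_diff mult.commute[of _ pi] abs_mult)
    ultimately show ?thesis by simp
  qed
  ultimately show ?thesis
    by (subst has_integral_cong[symmetric]) auto
qed

lemma has_integral_abs_cos_arches:
  "((\<lambda>t. \<bar>cos t\<bar>) has_integral 2 * real k)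
     {of_int n * pi - pi / 2..(of_int n + real k) * pi - pi / 2}"
proof (induction k)
  case (Suc k)
  have "((\<lambda>t. \<bar>cos t\<bar>) has_integral 2) {(of_int n + real k) * pi - pi / 2..(of_int n + real (Suc k)) * pi - pi / 2}"
    using has_integral_abs_cos_arch[of "n + int k"] by (simp add: algebra_simps)
  from has_integral_combine[OF _ _ Suc.IH this] show ?case
    by (simp add: algebra_simps)
qed (simp add: has_integral_refl)

text \<open>Enlarging \<open>{a..b}\<close> to a union of whole arches adds at most two of them, of area 2 each; this
  accounts for the error term 4, which does not depend on the interval.\<close>
lemma integral_abs_cos_le:
  fixes a b :: real
  assumes "a \<le> b"
  shows "integral {a..b} (\<lambda>t. \<bar>cos t\<bar>) \<le> 2 / pi * (b - a) + 4"
proof -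
  define n where "n = \<lfloor>(a + pi / 2) / pi\<rfloor>"
  define m where "m = \<lceil>(b + pi / 2) / pi\<rceil>"
  have n: "of_int n \<le> (a + pi / 2) / pi" "(a + pi / 2) / pi < of_int n + 1"
    unfolding n_def by linarith+
  have m: "(b + pi / 2) / pi \<le> of_int m" "of_int m < (b + pi / 2) / pi + 1"
    unfolding m_def by linarith+
  have "(a + pi / 2) / pi \<le> (b + pi / 2) / pi"
    using assms by (simp add: divide_right_mono)
  with n m have "n \<le> m" by linarith
  then have k: "of_int n + real (nat (m - n)) = of_int m" by simp
  have nm: "((\<lambda>t. \<bar>cos t\<bar>) has_integral 2 * (of_int m - of_int n)) {of_int n * pi - pi / 2..of_int m * pi - pi / 2}"
    using has_integral_abs_cos_arches[of "nat (m - n)" n] \<open>n \<le> m\<close> unfolding k by simp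
  have "integral {a..b} (\<lambda>t. \<bar>cos t\<bar>) \<le> integral {of_int n * pi - pi / 2..of_int m * pi - pi / 2} (\<lambda>t. \<bar>cos t\<bar>)"
    using n m nm
    by (intro integral_subset_le) (auto simp: field_simps intro!: integrable_continuous_real continuous_intros)
  also have "\<dots> = 2 * (of_int m - of_int n)"
    using nm by (rule integral_unique)
  also have "\<dots> \<le> 2 * ((b + pi / 2) / pi - (a + pi / 2) / pi + 2)"
    using mult_left_mono[of "of_int m - of_int n" "(b + pi / 2) / pi - (a + pi / 2) / pi + 2" "2 :: real"]
      less_imp_le[OF n(2)] less_imp_le[OF m(2)] by argo
  also have "\<dots> = 2 / pi * (b - a) + 4"
    by (simp add: field_simps)
  finally show ?thesis .
qed

text \<open>Substituting \<open>t = y * x\<close> turns the mean over \<open>{l..u}\<close> into one over an interval of length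
  \<open>y * (u - l)\<close>, so for large \<open>y\<close> it approaches the mean over a period.\<close>
lemma mean_abs_cos_le:
  fixes l u y :: real
  assumes "l < u" "0 < y"
  shows "(\<integral>\<^sup>+x. ennreal \<bar>cos (y * x)\<bar> \<partial>uniform_measure (restrict_space lborel {l..u}) {l..u})
           \<le> ennreal (2 / pi + 4 / (y * (u - l)))"
proof -
  let ?J = "integral {l..u} (\<lambda>x. \<bar>cos (y * x)\<bar>)"
  have ems: "emeasure (restrict_space lborel {l..u}) {l..u} = ennreal (u - l)"
    using assms by (subst emeasure_restrict_space) auto
  have "(\<integral>\<^sup>+x. ennreal \<bar>cos (y * x)\<bar> \<partial>uniform_measure (restrict_space lborel {l..u}) {l..u})
      = (\<integral>\<^sup>+x. ennreal \<bar>cos (y * x)\<bar> * indicator {l..u} x \<partial>lborel) / ennreal (u - l)"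
    by (subst nn_integral_uniform_measure)
       (auto simp: ems nn_integral_restrict_space sets_restrict_space mult.assoc
          intro!: measurable_restrict_space1 arg_cong2[where f = "(/)"] nn_integral_cong
          split: split_indicator)
  also have "(\<integral>\<^sup>+x. ennreal \<bar>cos (y * x)\<bar> * indicator {l..u} x \<partial>lborel)
      = (\<integral>\<^sup>+x. ennreal (\<bar>cos (y * x)\<bar> * indicator {l..u} x) \<partial>lborel)"
    by (intro nn_integral_cong) (auto split: split_indicator)
  also have "\<dots> = ennreal ?J"
  proof (rule nn_integral_has_integral_lborel)
    have "(\<lambda>x. \<bar>cos (y * x)\<bar>) integrable_on {l..u}"
      by (intro integrable_continuous_real continuous_intros)
    then have "((\<lambda>x. if x \<in> {l..u} then \<bar>cos (y * x)\<bar> else 0) has_integral ?J) UNIV"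
      by (subst has_integral_restrict_UNIV) (rule integrable_integral)
    moreover have "(\<lambda>x. if x \<in> {l..u} then \<bar>cos (y * x)\<bar> else 0) = (\<lambda>x. \<bar>cos (y * x)\<bar> * indicator {l..u} x)"
      by (auto split: split_indicator)
    ultimately show "((\<lambda>x. \<bar>cos (y * x)\<bar> * indicator {l..u} x) has_integral ?J) UNIV" by simp
  qed auto
  also have "ennreal ?J / ennreal (u - l) = ennreal (?J / (u - l))"
    using assms by (intro divide_ennreal) (auto intro!: integral_nonneg integrable_continuous_real continuous_intros)
  also have "\<dots> \<le> ennreal (2 / pi + 4 / (y * (u - l)))"
  proof (rule ennreal_leI)
    have "?J = integral {y * l..y * u} (\<lambda>t. \<bar>cos t\<bar>) / y"
    proof -
      have "((\<lambda>t. \<bar>cos t\<bar>) has_integral integral {y * l..y * u} (\<lambda>t. \<bar>cos t\<bar>)) (cbox (y * l) (y * u))"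
        by (auto intro!: integrable_integral integrable_continuous_real continuous_intros)
      from has_integral_affinity[OF this, of y 0] assms
      have "((\<lambda>x. \<bar>cos (y * x)\<bar>) has_integral (1 / y) * integral {y * l..y * u} (\<lambda>t. \<bar>cos t\<bar>)) {l..u}"
        by (auto simp: image_affinity_atLeastAtMost_div_diff field_simps)
      then show ?thesis by (simp add: integral_unique)
    qed
    also have "\<dots> \<le> (2 / pi * (y * u - y * l) + 4) / y"
      using assms by (intro divide_right_mono integral_abs_cos_le) auto
    finally have "?J / (u - l) \<le> (2 / pi * (y * u - y * l) + 4) / y / (u - l)"
      using assms by (intro divide_right_mono) auto
    also have "\<dots> = 2 / pi + 4 / (y * (u - l))"
      using assms by (simp add: field_simps)
    finally show "?J / (u - l) \<le> 2 / pi + 4 / (y * (u - l))" .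
  qed
  finally show ?thesis .
qed

section \<open>Contraction products and independent ratios\<close>

definition contraction :: "(nat \<Rightarrow> real) \<Rightarrow> nat \<Rightarrow> real" where
  "contraction \<omega> n = (\<Prod>j<n. \<omega> j)"

lemma contraction_0 [simp]: "contraction \<omega> 0 = 1"
  by (simp add: contraction_def)

lemma contraction_Suc: "contraction \<omega> (Suc n) = contraction \<omega> n * \<omega> n"
  by (simp add: contraction_def)

lemma contraction_Suc_shift: "contraction \<omega> (Suc n) = \<omega> 0 * contraction (\<lambda>j. \<omega> (Suc j)) n"
  unfolding contraction_def by (rule prod.lessThan_Suc_shift)

lemma contraction_case_nat: "contraction (case_nat x \<omega>) (Suc n) = x * contraction \<omega> n"
  by (simp add: contraction_Suc_shift)

lemma contraction_pos:
  assumes "\<And>k. 0 < \<omega> k"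
  shows "0 < contraction \<omega> n"
  unfolding contraction_def using assms by (intro prod_pos) auto

lemma contraction_antimono:
  assumes "\<And>k. 0 < \<omega> k" "\<And>k. \<omega> k \<le> 1" "k \<le> n"
  shows "contraction \<omega> n \<le> contraction \<omega> k"
  using assms(3)
proof (induction rule: dec_induct)
  case (step n)
  have "contraction \<omega> (Suc n) \<le> contraction \<omega> n * 1"
    unfolding contraction_Suc using contraction_pos[of \<omega> n, OF assms(1)] assms(2)
    by (intro mult_left_mono) auto
  with step.IH show ?case by simp
qed simp

lemma measurable_contraction [measurable]:
  assumes "(\<lambda>x. x) \<in> borel_measurable N"
  shows "(\<lambda>\<omega>. contraction \<omega> n) \<in> borel_measurable (\<Pi>\<^sub>M k\<in>(UNIV :: nat set). N)"
proof -
  have [measurable]: "(\<lambda>\<omega>. \<omega> j) \<in> borel_measurable (\<Pi>\<^sub>M k\<in>(UNIV :: nat set). N)" for j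
    by (rule measurable_compose[OF measurable_component_singleton[of j UNIV "\<lambda>_. N"] assms]) simp
  show ?thesis unfolding contraction_def by measurable
qed

text \<open>Splitting off the first coordinate of an i.i.d. sequence. Together with the recursions for
  \<open>case_nat\<close> it plays the role of conditioning in the inductions below.\<close>
lemma nn_integral_PiM_nat_split:
  assumes "prob_space N" and G: "G \<in> borel_measurable (\<Pi>\<^sub>M k\<in>(UNIV :: nat set). N)"
  shows "(\<integral>\<^sup>+\<omega>. G \<omega> \<partial>(\<Pi>\<^sub>M k\<in>(UNIV :: nat set). N)) =
    (\<integral>\<^sup>+x. (\<integral>\<^sup>+\<omega>. G (case_nat x \<omega>) \<partial>(\<Pi>\<^sub>M k\<in>(UNIV :: nat set). N)) \<partial>N)"
proof -
  interpret N: prob_space N by fact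
  interpret sequence_space N ..
  note [measurable] = G
  have "(\<integral>\<^sup>+\<omega>. G \<omega> \<partial>S) = (\<integral>\<^sup>+\<omega>. G \<omega> \<partial>distr (N \<Otimes>\<^sub>M S) S (\<lambda>(s, \<omega>). case_nat s \<omega>))"
    by (simp only: PiM_iter)
  also have "\<dots> = (\<integral>\<^sup>+p. G (case_nat (fst p) (snd p)) \<partial>(N \<Otimes>\<^sub>M S))"
    by (subst nn_integral_distr) (auto simp: case_prod_beta)
  also have "\<dots> = (\<integral>\<^sup>+x. (\<integral>\<^sup>+\<omega>. G (case_nat x \<omega>) \<partial>S) \<partial>N)"
    by (subst nn_integral_fst[symmetric]) auto
  finally show ?thesis .
qed

lemma nn_integral_prod_iid:
  assumes "prob_space N" and [measurable]: "\<phi> \<in> borel_measurable N"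
  shows "(\<integral>\<^sup>+\<omega>. (\<Prod>k<n. \<phi> (\<omega> k)) \<partial>(\<Pi>\<^sub>M k\<in>(UNIV :: nat set). N)) = (\<integral>\<^sup>+x. \<phi> x \<partial>N) ^ n"
proof (induction n)
  case 0
  interpret prob_space "\<Pi>\<^sub>M k\<in>(UNIV :: nat set). N"
    by (intro prob_space_PiM assms)
  show ?case by (simp add: emeasure_space_1)
next
  case (Suc n)
  show ?case
    by (subst nn_integral_PiM_nat_split[OF assms(1)])
       (auto simp: prod.lessThan_Suc_shift nn_integral_cmult nn_integral_multc Suc.IH
          simp del: prod.lessThan_Suc)
qed

section \<open>Expected products of cosines\<close>

text \<open>The indicators switch the product off as soon as the argument scale \<open>y * contraction \<omega> k\<close> drops
  below \<open>y\<^sub>0\<close>, where the bound on the mean of a single factor is no longer available. The guard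
  makes a bound on the expectation hold for every \<open>y\<close>, without reference to the typical
  behaviour of \<open>\<omega>\<close>.\<close>
definition guarded_cos_prod :: "real \<Rightarrow> nat \<Rightarrow> real \<Rightarrow> (nat \<Rightarrow> real) \<Rightarrow> ennreal" where
  "guarded_cos_prod y\<^sub>0 n y \<omega> = (\<Prod>k<n. indicator {y\<^sub>0..} (y * contraction \<omega> k)
      * ennreal \<bar>cos (y * contraction \<omega> (Suc k))\<bar>)"

lemma guarded_cos_prod_case_nat:
  "guarded_cos_prod y\<^sub>0 (Suc n) y (case_nat x \<omega>) =
     indicator {y\<^sub>0..} y * ennreal \<bar>cos (y * x)\<bar> * guarded_cos_prod y\<^sub>0 n (y * x) \<omega>"
  unfolding guarded_cos_prod_def
  by (simp add: prod.lessThan_Suc_shift contraction_case_nat mult.assoc del: prod.lessThan_Suc)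

lemma measurable_guarded_cos_prod:
  assumes [measurable]: "(\<lambda>x. x) \<in> borel_measurable N"
  shows "(\<lambda>p. guarded_cos_prod y\<^sub>0 n (fst p) (snd p))
    \<in> borel_measurable (borel \<Otimes>\<^sub>M (\<Pi>\<^sub>M k\<in>(UNIV :: nat set). N))"
  unfolding guarded_cos_prod_def by measurable

text \<open>Given the first ratio \<open>x\<close>, the remaining factors form the same product for the shifted sequence,
  with \<open>y * x\<close> in place of \<open>y\<close>. Since the induction hypothesis is uniform in \<open>y\<close>, it can be applied
  before integrating over \<open>x\<close>.\<close>
lemma nn_integral_guarded_cos_prod_le:
  assumes "prob_space N" and id[measurable]: "(\<lambda>x. x) \<in> borel_measurable N"
    and \<beta>: "\<And>y. y\<^sub>0 \<le> y \<Longrightarrow> (\<integral>\<^sup>+x. ennreal \<bar>cos (y * x)\<bar> \<partial>N) \<le> \<beta>"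
  shows "(\<integral>\<^sup>+\<omega>. guarded_cos_prod y\<^sub>0 n y \<omega> \<partial>(\<Pi>\<^sub>M k\<in>(UNIV :: nat set). N)) \<le> \<beta> ^ n"
proof (induction n arbitrary: y)
  case 0
  interpret prob_space "\<Pi>\<^sub>M k\<in>(UNIV :: nat set). N"
    by (intro prob_space_PiM assms)
  show ?case by (simp add: emeasure_space_1 guarded_cos_prod_def)
next
  case (Suc n)
  let ?S = "\<Pi>\<^sub>M k\<in>(UNIV :: nat set). N"
  note [measurable] = measurable_guarded_cos_prod[OF id]
  have [measurable]: "guarded_cos_prod y\<^sub>0 m z \<in> borel_measurable ?S" for m z
    using measurable_compose[OF _ measurable_guarded_cos_prod[OF id], of "\<lambda>\<omega>. (z, \<omega>)" ?S] by simp
  have "(\<integral>\<^sup>+\<omega>. guarded_cos_prod y\<^sub>0 (Suc n) y \<omega> \<partial>?S) =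
      (\<integral>\<^sup>+x. indicator {y\<^sub>0..} y * ennreal \<bar>cos (y * x)\<bar> * (\<integral>\<^sup>+\<omega>. guarded_cos_prod y\<^sub>0 n (y * x) \<omega> \<partial>?S) \<partial>N)"
    by (subst nn_integral_PiM_nat_split[OF assms(1)])
       (auto simp: guarded_cos_prod_case_nat nn_integral_cmult)
  also have "\<dots> \<le> (\<integral>\<^sup>+x. indicator {y\<^sub>0..} y * ennreal \<bar>cos (y * x)\<bar> * \<beta> ^ n \<partial>N)"
    by (intro nn_integral_mono mult_left_mono Suc.IH) auto
  also have "\<dots> = indicator {y\<^sub>0..} y * (\<integral>\<^sup>+x. ennreal \<bar>cos (y * x)\<bar> \<partial>N) * \<beta> ^ n"
    by (simp add: nn_integral_cmult nn_integral_multc mult.assoc)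
  also have "\<dots> \<le> \<beta> * \<beta> ^ n"
    using \<beta>[of y] by (intro mult_right_mono) (auto split: split_indicator)
  finally show ?case by simp
qed

section \<open>Growth of the random contraction products\<close>

lemma exp_le_quadratic:
  fixes x :: real
  assumes "\<bar>x\<bar> \<le> 1"
  shows "exp x \<le> 1 + x + x\<^sup>2"
proof (cases "0 \<le> x")
  case True
  then show ?thesis using assms by (intro exp_bound) auto
next
  case False
  have "1 = exp x * exp (- x)" by (simp flip: exp_add)
  also have "\<dots> \<ge> exp x * (1 - x)"
    using exp_ge_add_one_self[of "- x"] by (intro mult_left_mono) auto
  finally have "exp x * (1 - x) \<le> 1" .
  also have "1 \<le> (1 + x + x\<^sup>2) * (1 - x)"
  proof -
    have "x ^ 3 \<le> 0" using False by (simp add: power_le_zero_eq)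
    then show ?thesis by (simp add: algebra_simps power2_eq_square power3_eq_cube)
  qed
  finally show ?thesis using False by (simp add: mult_le_cancel_right)
qed

text \<open>To first order the exponential moment is \<open>1 + s * E X\<close>, and the quadratic error is dominated by the
  negative linear term once \<open>s\<close> is small. This is the input for the Chernoff bound.\<close>
lemma exp_moment_less_1:
  fixes X :: "'a \<Rightarrow> real"
  assumes "prob_space N" and [measurable]: "X \<in> borel_measurable N"
    and B: "AE x in N. \<bar>X x\<bar> \<le> B" and neg: "(\<integral>x. X x \<partial>N) < 0"
  shows "\<exists>s>0. \<exists>\<gamma>\<ge>0. \<gamma> < 1 \<and> (\<integral>\<^sup>+x. ennreal (exp (s * X x)) \<partial>N) \<le> ennreal \<gamma>"
proof -
  interpret prob_space N by fact
  define C where "C = max B 1"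
  define m where "m = - (\<integral>x. X x \<partial>N)"
  \<comment> \<open>The first bound keeps \<open>s * X\<close> in the range of the quadratic estimate for the exponential, the
      second makes the quadratic term at most half of the linear one.\<close>
  define s where "s = min (1 / C) (m / (2 * C\<^sup>2))"
  have C: "1 \<le> C" "AE x in N. \<bar>X x\<bar> \<le> C" using B unfolding C_def by auto
  have m: "0 < m" using neg by (simp add: m_def)
  have s: "0 < s" "s * C \<le> 1" "s * C\<^sup>2 \<le> m / 2"
  proof -
    show "0 < s" using C(1) m by (simp add: s_def)
    have "s \<le> 1 / C" "s \<le> m / (2 * C\<^sup>2)" by (simp_all add: s_def)
    then show "s * C \<le> 1" "s * C\<^sup>2 \<le> m / 2"
      using C(1) by (simp_all add: field_simps)
  qed
  have [simp]: "integrable N X"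
    using C(2) by (intro integrable_const_bound[of _ C]) auto
  have ptw: "AE x in N. exp (s * X x) \<le> 1 + s * X x + s\<^sup>2 * C\<^sup>2"
    using C(2)
  proof eventually_elim
    case (elim x)
    have "\<bar>s * X x\<bar> \<le> s * C"
      using elim s(1) by (simp add: abs_mult)
    then have "exp (s * X x) \<le> 1 + s * X x + (s * X x)\<^sup>2"
      using s(2) by (intro exp_le_quadratic) auto
    also have "(s * X x)\<^sup>2 \<le> (s * C)\<^sup>2"
      using \<open>\<bar>s * X x\<bar> \<le> s * C\<close> by (metis abs_ge_zero power2_abs power_mono)
    finally show ?case by (simp add: power_mult_distrib)
  qed
  have "(\<integral>\<^sup>+x. ennreal (exp (s * X x)) \<partial>N) \<le> (\<integral>\<^sup>+x. ennreal (1 + s * X x + s\<^sup>2 * C\<^sup>2) \<partial>N)"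
    using ptw by (intro nn_integral_mono_AE) (auto intro: ennreal_leI)
  also have "\<dots> = ennreal (\<integral>x. 1 + s * X x + s\<^sup>2 * C\<^sup>2 \<partial>N)"
    using ptw by (intro nn_integral_eq_integral) (auto elim!: eventually_mono intro: order_trans[OF exp_ge_zero])
  also have "(\<integral>x. 1 + s * X x + s\<^sup>2 * C\<^sup>2 \<partial>N) = 1 - s * m + s * (s * C\<^sup>2)"
    by (simp add: m_def prob_space power2_eq_square)
  finally have le: "(\<integral>\<^sup>+x. ennreal (exp (s * X x)) \<partial>N) \<le> ennreal (1 - s * m + s * (s * C\<^sup>2))" .
  have "s * (s * C\<^sup>2) \<le> s * (m / 2)"
    using s by (intro mult_left_mono) auto
  moreover have "0 < s * m" using s m by simp
  ultimately have "1 - s * m + s * (s * C\<^sup>2) < 1" by simp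
  then have "max 0 (1 - s * m + s * (s * C\<^sup>2)) < 1" by simp
  moreover have "(\<integral>\<^sup>+x. ennreal (exp (s * X x)) \<partial>N) \<le> ennreal (max 0 (1 - s * m + s * (s * C\<^sup>2)))"
    using le by (rule order_trans) (auto intro: ennreal_leI)
  ultimately show ?thesis using s(1) by (metis max.cobounded1)
qed

text \<open>This is the part of the strong law for the logarithms of the ratios that is needed here. By the
  Chernoff bound, the event \<open>contraction \<omega> n \<le> \<rho> ^ n\<close> has exponentially small probability; by
  Borel-Cantelli it then occurs only finitely often.\<close>
lemma AE_eventually_power_le_contraction:
  assumes "prob_space N" and id[measurable]: "(\<lambda>x. x) \<in> borel_measurable N"
    and l: "0 < l" "\<And>x. x \<in> space N \<Longrightarrow> x \<in> {l..u}"
    and \<rho>: "0 < \<rho>" "ln \<rho> < (\<integral>x. ln x \<partial>N)"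
  shows "AE \<omega> in (\<Pi>\<^sub>M k\<in>(UNIV :: nat set). N).
    eventually (\<lambda>n. \<rho> ^ n \<le> contraction \<omega> n) sequentially"
proof -
  let ?S = "\<Pi>\<^sub>M k\<in>(UNIV :: nat set). N"
  interpret N: prob_space N by fact
  interpret S: prob_space ?S by (intro prob_space_PiM assms)
  have bnd: "\<bar>ln x\<bar> \<le> \<bar>ln l\<bar> + \<bar>ln u\<bar>" if "x \<in> space N" for x
  proof -
    have "ln l \<le> ln x" "ln x \<le> ln u" using l(1) l(2)[OF that] by auto
    then show ?thesis by linarith
  qed
  have int: "integrable N ln"
    using bnd by (intro N.integrable_const_bound[of _ "\<bar>ln l\<bar> + \<bar>ln u\<bar>"]) auto
  have "\<exists>s>0. \<exists>\<gamma>\<ge>0. \<gamma> < 1 \<and> (\<integral>\<^sup>+x. ennreal (exp (s * (ln \<rho> - ln x))) \<partial>N) \<le> ennreal \<gamma>"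
  proof (rule exp_moment_less_1)
    have "\<bar>ln \<rho> - ln x\<bar> \<le> \<bar>ln \<rho>\<bar> + (\<bar>ln l\<bar> + \<bar>ln u\<bar>)" if "x \<in> space N" for x
      using bnd[OF that] by linarith
    then show "AE x in N. \<bar>ln \<rho> - ln x\<bar> \<le> \<bar>ln \<rho>\<bar> + (\<bar>ln l\<bar> + \<bar>ln u\<bar>)" by auto
  qed (use int \<rho> in \<open>auto simp: N.prob_space intro: assms\<close>)
  then obtain s \<gamma> where s: "0 < s" and \<gamma>: "0 \<le> \<gamma>" "\<gamma> < 1"
    and le: "(\<integral>\<^sup>+x. ennreal (exp (s * (ln \<rho> - ln x))) \<partial>N) \<le> ennreal \<gamma>" by blast
  define g where "g n \<omega> = (\<Prod>k<n. ennreal (exp (s * (ln \<rho> - ln (\<omega> k)))))" for n and \<omega> :: "nat \<Rightarrow> real"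
  have [measurable]: "(\<lambda>\<omega>. \<omega> j) \<in> borel_measurable ?S" for j
    by (rule measurable_compose[OF measurable_component_singleton[of j UNIV "\<lambda>_. N"] id]) simp
  have [measurable]: "g n \<in> borel_measurable ?S" for n
    unfolding g_def by measurable
  define A where "A n = {\<omega> \<in> space ?S. 1 \<le> g n \<omega>}" for n
  have [measurable]: "A n \<in> sets ?S" for n unfolding A_def by measurable
  have em: "emeasure ?S (A n) \<le> ennreal (\<gamma> ^ n)" for n
  proof -
    have "emeasure ?S (A n) \<le> (\<integral>\<^sup>+\<omega>. g n \<omega> \<partial>?S)"
      using nn_integral_Markov_inequality[where u = "g n" and M = ?S and A = "space ?S" and c = 1]
      by (simp add: A_def cong: nn_integral_cong)
    also have "\<dots> = (\<integral>\<^sup>+x. ennreal (exp (s * (ln \<rho> - ln x))) \<partial>N) ^ n"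
      unfolding g_def by (rule nn_integral_prod_iid) (use assms in auto)
    also have "\<dots> \<le> ennreal \<gamma> ^ n" using le by (rule power_mono) simp
    also have "\<dots> = ennreal (\<gamma> ^ n)" using \<gamma> by (simp add: ennreal_power)
    finally show ?thesis .
  qed
  have "AE \<omega> in ?S. eventually (\<lambda>n. \<omega> \<in> space ?S - A n) sequentially"
  proof (rule borel_cantelli_AE1)
    show "summable (\<lambda>n. measure ?S (A n))"
    proof (rule summable_comparison_test')
      show "summable (\<lambda>n. \<gamma> ^ n)" using \<gamma> by (auto intro: summable_geometric)
      show "norm (measure ?S (A n)) \<le> \<gamma> ^ n" for n
        using em[of n] \<gamma> by (simp add: S.emeasure_eq_measure)
    qed
  qed (auto simp: S.emeasure_eq_measure)
  then show ?thesis
  proof (rule AE_mp[OF _ AE_I2], intro impI)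
    fix \<omega> assume \<omega>: "\<omega> \<in> space ?S" and ev: "eventually (\<lambda>n. \<omega> \<in> space ?S - A n) sequentially"
    have pos: "0 < \<omega> k" for k
      using \<omega> l(1) l(2)[of "\<omega> k"] by (auto simp: space_PiM PiE_iff)
    have g_eq: "g n \<omega> = ennreal (exp (s * (real n * ln \<rho> - ln (contraction \<omega> n))))" for n
    proof (induction n)
      case (Suc n)
      have "g (Suc n) \<omega> = g n \<omega> * ennreal (exp (s * (ln \<rho> - ln (\<omega> n))))"
        by (simp add: g_def)
      also have "\<dots> = ennreal (exp (s * (real n * ln \<rho> - ln (contraction \<omega> n)) + s * (ln \<rho> - ln (\<omega> n))))"
        unfolding Suc.IH by (simp add: exp_add ennreal_mult)
      also have "s * (real n * ln \<rho> - ln (contraction \<omega> n)) + s * (ln \<rho> - ln (\<omega> n)) =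
          s * (real (Suc n) * ln \<rho> - ln (contraction \<omega> (Suc n)))"
        using contraction_pos[of \<omega> n] pos pos[of n, THEN less_imp_neq]
        by (simp add: contraction_Suc ln_mult algebra_simps)
      finally show ?case .
    qed (simp add: g_def)
    from ev show "eventually (\<lambda>n. \<rho> ^ n \<le> contraction \<omega> n) sequentially"
    proof eventually_elim
      case (elim n)
      then have "g n \<omega> < 1" by (auto simp: A_def not_le)
      then have "s * (real n * ln \<rho> - ln (contraction \<omega> n)) < 0"
        unfolding g_eq by (simp add: ennreal_less_one_iff)
      then have "ln (\<rho> ^ n) < ln (contraction \<omega> n)"
        using s \<rho> by (simp add: mult_less_0_iff ln_realpow)
      then show ?case
        using \<rho> contraction_pos[of \<omega> n] pos by simp
    qed
  qed
qed

section \<open>The characteristic function of the convolution\<close>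

text \<open>The coding map is the composition of the contraction for the first digit with the coding map of
  the shifted sequence of ratios. This self-similarity yields the product form of the
  characteristic function.\<close>
lemma coding_map_case_nat:
  assumes "0 < l" "u < 1" "\<And>k. \<omega> k \<in> {l..u}" "\<And>j. a j \<in> {0, 1}"
  shows "coding_map \<omega> (case_nat s a) = \<omega> 0 * s + \<omega> 0 * coding_map (\<lambda>k. \<omega> (Suc k)) a"
proof -
  let ?f = "\<lambda>j. a j * (\<Prod>k\<le>j. \<omega> (Suc k))"
  let ?g = "\<lambda>j. case_nat s a j * (\<Prod>k\<le>j. \<omega> k)"
  have "?f sums coding_map (\<lambda>k. \<omega> (Suc k)) a"
    unfolding coding_map_def
    by (rule summable_sums, rule summable_coding_map[of l u]) (use assms in auto)
  then have "(\<lambda>j. \<omega> 0 * ?f j) sums (\<omega> 0 * coding_map (\<lambda>k. \<omega> (Suc k)) a)"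
    by (rule sums_mult)
  moreover have "?g (Suc j) = \<omega> 0 * ?f j" for j
    by (simp add: prod.atMost_Suc_shift mult_ac del: prod.atMost_Suc)
  ultimately have "(\<lambda>j. ?g (Suc j)) sums (\<omega> 0 * coding_map (\<lambda>k. \<omega> (Suc k)) a)"
    by (simp only:)
  then have "?g sums (\<omega> 0 * coding_map (\<lambda>k. \<omega> (Suc k)) a + ?g 0)"
    by (rule sums_Suc)
  then show ?thesis
    unfolding coding_map_def[of \<omega> "case_nat s a"] by (simp add: sums_iff mult_ac)
qed

lemma real_distribution_random_bernoulli_convolution:
  "real_distribution (random_bernoulli_convolution \<omega>)"
  unfolding random_bernoulli_convolution_def
  by (intro prob_space.real_distribution_distr prob_space_bernoulli_measure measurable_coding_map)

lemma cmod_mean_iexp: "cmod ((1 + iexp x) / 2) = \<bar>cos (x / 2)\<bar>"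
proof -
  have "1 + iexp x = iexp (x / 2) * (iexp (x / 2) + iexp (- (x / 2)))"
    by (simp add: distrib_left flip: exp_add)
  also have "iexp (x / 2) + iexp (- (x / 2)) = of_real (2 * cos (x / 2))"
    by (simp add: complex_eq_iff Re_exp Im_exp)
  finally show ?thesis
    by (simp add: norm_mult norm_divide del: of_real_mult of_real_divide)
qed

lemma char_random_bernoulli_convolution_step:
  assumes "0 < l" "u < 1" "\<And>k. \<omega> k \<in> {l..u}"
  shows "char (random_bernoulli_convolution \<omega>) t =
    (1 + iexp (t * \<omega> 0)) / 2 * char (random_bernoulli_convolution (\<lambda>k. \<omega> (Suc k))) (t * \<omega> 0)"
proof -
  define C :: "real measure" where "C = uniform_count_measure {0, 1}"
  interpret C: prob_space C unfolding C_def by (intro prob_space_uniform_count_measure) auto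
  interpret sequence_space C ..
  interpret Q: pair_prob_space C S ..
  have S: "bernoulli_measure = S" unfolding C_def bernoulli_measure_def ..
  let ?\<omega> = "\<lambda>k. \<omega> (Suc k)"
  note [measurable] = measurable_coding_map[of \<omega>, unfolded S] measurable_coding_map[of ?\<omega>, unfolded S]
  have spC: "space C = {0, 1}" by (simp add: C_def space_uniform_count_measure)
  have [measurable]: "(\<lambda>x. x) \<in> borel_measurable C"
    by (auto simp: C_def measurable_def space_uniform_count_measure sets_uniform_count_measure)
  have int: "integrable (C \<Otimes>\<^sub>M S) (\<lambda>p. iexp (t * coding_map \<omega> (case_nat (fst p) (snd p))))"
    by (rule Q.integrable_const_bound[of _ 1]) auto
  have "char (random_bernoulli_convolution \<omega>) t = (CLINT a|S. iexp (t * coding_map \<omega> a))"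
    unfolding char_def random_bernoulli_convolution_def S
    by (subst integral_distr) auto
  also have "\<dots> = (CLINT a|distr (C \<Otimes>\<^sub>M S) S (\<lambda>(s, a). case_nat s a). iexp (t * coding_map \<omega> a))"
    by (simp only: PiM_iter)
  also have "\<dots> = (CLINT p|C \<Otimes>\<^sub>M S. iexp (t * coding_map \<omega> (case_nat (fst p) (snd p))))"
    by (subst integral_distr) (auto simp: case_prod_beta)
  also have "\<dots> = (CLINT s|C. (CLINT a|S. iexp (t * coding_map \<omega> (case_nat s a))))"
    using Q.integral_fst'[OF int] by simp
  also have "\<dots> = (CLINT s|C. iexp (t * \<omega> 0 * s) * char (random_bernoulli_convolution ?\<omega>) (t * \<omega> 0))"
  proof (intro Bochner_Integration.integral_cong refl)
    fix s assume "s \<in> space C"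
    have "(CLINT a|S. iexp (t * coding_map \<omega> (case_nat s a))) =
        (CLINT a|S. iexp (t * \<omega> 0 * s) * iexp (t * \<omega> 0 * coding_map ?\<omega> a))"
    proof (intro Bochner_Integration.integral_cong refl)
      fix a assume "a \<in> space S"
      then have "a j \<in> {0, 1}" for j by (auto simp: space_PiM PiE_iff spC)
      from coding_map_case_nat[OF assms this]
      show "iexp (t * coding_map \<omega> (case_nat s a)) = iexp (t * \<omega> 0 * s) * iexp (t * \<omega> 0 * coding_map ?\<omega> a)"
        by (simp add: algebra_simps flip: exp_add)
    qed
    also have "\<dots> = iexp (t * \<omega> 0 * s) * (CLINT a|S. iexp (t * \<omega> 0 * coding_map ?\<omega> a))"
      by (rule integral_mult_right_zero)
    also have "(CLINT a|S. iexp (t * \<omega> 0 * coding_map ?\<omega> a)) = char (random_bernoulli_convolution ?\<omega>) (t * \<omega> 0)"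
      unfolding char_def random_bernoulli_convolution_def S
      by (subst integral_distr) auto
    finally show "(CLINT a|S. iexp (t * coding_map \<omega> (case_nat s a))) =
      iexp (t * \<omega> 0 * s) * char (random_bernoulli_convolution ?\<omega>) (t * \<omega> 0)" .
  qed
  also have "\<dots> = (CLINT s|C. iexp (t * \<omega> 0 * s)) * char (random_bernoulli_convolution ?\<omega>) (t * \<omega> 0)"
    by (rule integral_mult_left_zero)
  also have "(CLINT s|C. iexp (t * \<omega> 0 * s)) = (1 + iexp (t * \<omega> 0)) / 2"
    unfolding C_def uniform_count_measure_def
    by (subst lebesgue_integral_point_measure_finite) (auto simp: scaleR_conv_of_real field_simps)
  finally show ?thesis .
qed

text \<open>Each digit contributes the factor \<open>(1 + iexp x) / 2\<close>, which has modulus \<open>\<bar>cos (x / 2)\<bar>\<close>; the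
  characteristic function of the remaining convolution is bounded by 1. The right-hand side
  uses \<open>\<bar>t\<bar>\<close> so that positive and negative frequencies can be treated together.\<close>
lemma cmod_char_random_bernoulli_convolution_le:
  assumes "0 < l" "u < 1" "\<And>k. \<omega> k \<in> {l..u}"
  shows "cmod (char (random_bernoulli_convolution \<omega>) t)
    \<le> (\<Prod>k<n. \<bar>cos (\<bar>t\<bar> / 2 * contraction \<omega> (Suc k))\<bar>)"
proof -
  have "cmod (char (random_bernoulli_convolution \<omega>) t) \<le> (\<Prod>k<n. \<bar>cos (t / 2 * contraction \<omega> (Suc k))\<bar>)"
    using assms(3)
  proof (induction n arbitrary: \<omega> t)
    case 0
    show ?case
      using real_distribution.cmod_char_le_1[OF real_distribution_random_bernoulli_convolution] by simp
  next
    case (Suc n)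
    let ?\<omega> = "\<lambda>k. \<omega> (Suc k)"
    have "cmod (char (random_bernoulli_convolution \<omega>) t) =
        \<bar>cos (t * \<omega> 0 / 2)\<bar> * cmod (char (random_bernoulli_convolution ?\<omega>) (t * \<omega> 0))"
      using char_random_bernoulli_convolution_step[of l u \<omega> t, OF assms(1,2) Suc.prems]
      by (simp only: norm_mult cmod_mean_iexp)
    also have "\<dots> \<le> \<bar>cos (t * \<omega> 0 / 2)\<bar> * (\<Prod>k<n. \<bar>cos (t * \<omega> 0 / 2 * contraction ?\<omega> (Suc k))\<bar>)"
      using Suc.prems by (intro mult_left_mono Suc.IH) auto
    also have "\<dots> = (\<Prod>k<Suc n. \<bar>cos (t / 2 * contraction \<omega> (Suc k))\<bar>)"
      by (subst prod.lessThan_Suc_shift, subst (2) contraction_Suc_shift)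
         (simp add: contraction_Suc_shift[of \<omega>] contraction_Suc[of \<omega> 0] mult_ac)
    finally show ?case .
  qed
  also have "\<dots> = (\<Prod>k<n. \<bar>cos (\<bar>t\<bar> / 2 * contraction \<omega> (Suc k))\<bar>)"
    by (intro prod.cong refl) (simp add: abs_if)
  finally show ?thesis .
qed

section \<open>Continuous densities from integrable characteristic functions\<close>

text \<open>The inverse Fourier transform of the characteristic function; the real part makes it a real
  function from the outset.\<close>
definition inversion_density :: "real measure \<Rightarrow> real \<Rightarrow> real" where
  "inversion_density M x = Re (CLBINT t. iexp (- (t * x)) * char M t) / (2 * pi)"

context real_distribution
begin

context
  assumes char_int: "complex_integrable lborel (char M)"
begin

lemma integrable_iexp_char: "complex_integrable lborel (\<lambda>t. iexp (- (t * x)) * char M t)"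
  by (rule Bochner_Integration.integrable_bound[OF char_int]) (auto simp: norm_mult)

lemma continuous_inversion_density: "continuous_on UNIV (inversion_density M)"
proof -
  have "((\<lambda>y. CLBINT t. iexp (- (t * y)) * char M t) \<longlongrightarrow> (CLBINT t. iexp (- (t * x)) * char M t)) (at x)" for x
  proof (rule tendsto_at_iff_sequentially[THEN iffD2], intro allI impI)
    fix X :: "nat \<Rightarrow> real" assume "X \<longlonglongrightarrow> x"
    then have "(\<lambda>n. CLBINT t. iexp (- (t * X n)) * char M t) \<longlonglongrightarrow> (CLBINT t. iexp (- (t * x)) * char M t)"
      by (intro integral_dominated_convergence[where w = "\<lambda>t. cmod (char M t)"])
         (use char_int in \<open>auto simp: norm_mult intro!: tendsto_intros\<close>)
    then show "((\<lambda>y. CLBINT t. iexp (- (t * y)) * char M t) \<circ> X) \<longlonglongrightarrow> (CLBINT t. iexp (- (t * x)) * char M t)"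
      by (simp add: o_def)
  qed
  then show ?thesis
    unfolding inversion_density_def[abs_def] continuous_on_eq_continuous_at[OF open_UNIV] isCont_def
    by (intro ballI tendsto_intros) auto
qed

lemma inversion_density_le:
  "\<bar>inversion_density M x\<bar> \<le> (LBINT t. cmod (char M t)) / (2 * pi)"
proof -
  have "\<bar>Re (CLBINT t. iexp (- (t * x)) * char M t)\<bar> \<le> (LBINT t. cmod (iexp (- (t * x)) * char M t))"
    by (rule order_trans[OF abs_Re_le_cmod integral_norm_bound])
  then show ?thesis
    unfolding inversion_density_def by (simp add: norm_mult abs_divide divide_right_mono)
qed

text \<open>In Levy's inversion formula the kernel is the integral of \<open>iexp (- (t * x))\<close> over \<open>x\<close> in \<open>{a..b}\<close>.
  When the characteristic function is integrable, the truncation limit is an ordinary integral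
  and Fubini's theorem exchanges the two integrations.\<close>
lemma measure_Ioc_eq_integral_of_continuity_points:
  assumes "a \<le> b" "measure M {a} = 0" "measure M {b} = 0"
  shows "measure M {a<..b} = integral {a..b} (inversion_density M)"
proof -
  let ?\<Phi> = "\<lambda>t. (iexp (- (t * a)) - iexp (- (t * b))) / (\<i> * t) * char M t"
  let ?f = "\<lambda>x t. indicator {a..b} x *\<^sub>R (iexp (- (t * x)) * char M t)"
  have inner: "(CLBINT x. indicator {a..b} x *\<^sub>R iexp (- (t * x))) = (iexp (- (t * a)) - iexp (- (t * b))) / (\<i> * t)"
    if "t \<noteq> 0" for t
  proof -
    have "((\<lambda>x. iexp (- (t * x))) has_integral
        (iexp (- (t * b)) * (\<i> / t) - iexp (- (t * a)) * (\<i> / t))) {a..b}"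
      using that assms(1)
      by (intro fundamental_theorem_of_calculus)
         (auto intro!: derivative_eq_intros simp: has_vector_derivative_complex_iff Re_exp Im_exp
            simp flip: has_real_derivative_iff_has_vector_derivative)
    moreover have "set_integrable lborel {a..b} (\<lambda>x. iexp (- (t * x)))"
      by (intro borel_integrable_atLeastAtMost') (intro continuous_intros)
    ultimately have "(CLBINT x:{a..b}. iexp (- (t * x))) = iexp (- (t * b)) * (\<i> / t) - iexp (- (t * a)) * (\<i> / t)"
      by (simp add: set_borel_integral_eq_integral integral_unique)
    also have "\<dots> = (iexp (- (t * a)) - iexp (- (t * b))) / (\<i> * t)"
      using that by (simp add: field_simps)
    finally show ?thesis by (simp add: set_lebesgue_integral_def)
  qed
  have int2: "complex_integrable (lborel \<Otimes>\<^sub>M lborel) (\<lambda>p. ?f (fst p) (snd p))"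
  proof (rule lborel_pair.Fubini_integrable)
    show "integrable lborel (\<lambda>x. LBINT t. cmod (?f (fst (x, t)) (snd (x, t))))"
      by (simp add: norm_mult) (simp add: integrable_indicator_iff emeasure_lborel_Icc_eq)
    show "AE x in lborel. complex_integrable lborel (\<lambda>t. ?f (fst (x, t)) (snd (x, t)))"
      using integrable_iexp_char by (intro AE_I2) simp
  qed simp
  \<comment> \<open>At \<open>t = 0\<close> the quotient in \<open>?\<Phi>\<close> has the value 0 instead of \<open>b - a\<close>, so the identity only holds almost
      everywhere.\<close>
  have ae: "AE t in lborel. (CLBINT x. ?f x t) = ?\<Phi> t"
  proof -
    have "AE t in lborel. t \<noteq> (0::real)" by (rule AE_lborel_singleton)
    then show ?thesis
    proof eventually_elim
      case (elim t)
      have "(CLBINT x. ?f x t) = (CLBINT x. (indicator {a..b} x *\<^sub>R iexp (- (t * x))) * char M t)"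
        by simp
      also have "\<dots> = (CLBINT x. indicator {a..b} x *\<^sub>R iexp (- (t * x))) * char M t"
        by (rule integral_mult_left_zero)
      finally show ?case by (simp only: inner[OF elim])
    qed
  qed
  have int\<Phi>: "complex_integrable lborel ?\<Phi>"
  proof (rule integrable_cong_AE_imp[OF _ _ ae])
    show "complex_integrable lborel (\<lambda>t. CLBINT x. ?f x t)"
      by (rule lborel_pair.integrable_snd) (use int2 in \<open>simp only: case_prod_beta'\<close>)
  qed simp
  have "(\<lambda>T::nat. CLBINT t=-real T..real T. ?\<Phi> t) \<longlonglongrightarrow> (CLBINT t. ?\<Phi> t)"
  proof -
    have "(\<lambda>T::nat. CLBINT t. indicator {-real T<..<real T} t *\<^sub>R ?\<Phi> t) \<longlonglongrightarrow> (CLBINT t. ?\<Phi> t)"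
    proof (rule integral_dominated_convergence[where w = "\<lambda>t. cmod (?\<Phi> t)"])
      show "AE t in lborel. (\<lambda>T. indicator {-real T<..<real T} t *\<^sub>R ?\<Phi> t) \<longlonglongrightarrow> ?\<Phi> t"
      proof (intro AE_I2 tendsto_eventually)
        fix t :: real
        obtain K :: nat where "\<bar>t\<bar> < real K" using reals_Archimedean2 by blast
        then show "eventually (\<lambda>T. indicator {-real T<..<real T} t *\<^sub>R ?\<Phi> t = ?\<Phi> t) sequentially"
          by (intro eventually_mono[OF eventually_ge_at_top[of K]]) (subst indicator_simps(1), auto)
      qed
      show "integrable lborel (\<lambda>t. cmod (?\<Phi> t))" using int\<Phi> by (rule integrable_norm)
    qed (auto split: split_indicator)
    then show ?thesis
      by (simp add: interval_lebesgue_integral_def set_lebesgue_integral_def)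
  qed
  then have "(\<lambda>T::nat. 1 / (2 * pi) * (CLBINT t=-real T..real T. ?\<Phi> t)) \<longlonglongrightarrow> 1 / (2 * pi) * (CLBINT t. ?\<Phi> t)"
    by (intro tendsto_intros)
  moreover have "(\<lambda>T::nat. 1 / (2 * pi) * (CLBINT t=-real T..real T. ?\<Phi> t)) \<longlonglongrightarrow> of_real (measure M {a<..b})"
    using Levy_Inversion[OF assms] by simp
  ultimately have "of_real (measure M {a<..b}) = 1 / (2 * pi) * (CLBINT t. ?\<Phi> t)"
    by (intro LIMSEQ_unique)
  also have "(CLBINT t. ?\<Phi> t) = (CLBINT t. (CLBINT x. ?f x t))"
    using ae by (intro integral_cong_AE) auto
  also have "\<dots> = (CLBINT x. (CLBINT t. ?f x t))"
    by (rule lborel_pair.Fubini_integral) (use int2 in \<open>simp only: case_prod_beta'\<close>)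
  also have "\<dots> = (CLBINT x. indicator {a..b} x *\<^sub>R (CLBINT t. iexp (- (t * x)) * char M t))"
    by simp
  finally have "measure M {a<..b} = Re (1 / (2 * pi) * (CLBINT x. indicator {a..b} x *\<^sub>R (CLBINT t. iexp (- (t * x)) * char M t)))"
    by (metis Re_complex_of_real)
  also have "\<dots> = Re (CLBINT x. indicator {a..b} x *\<^sub>R (CLBINT t. iexp (- (t * x)) * char M t)) / (2 * pi)"
    unfolding times_complex.sel Re_complex_of_real Im_complex_of_real by simp
  also have "Re (CLBINT x. indicator {a..b} x *\<^sub>R (CLBINT t. iexp (- (t * x)) * char M t)) =
      (LBINT x. Re (indicator {a..b} x *\<^sub>R (CLBINT t. iexp (- (t * x)) * char M t)))"
  proof (intro integral_Re[symmetric])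
    have "complex_integrable lborel (\<lambda>x. CLBINT t. ?f x t)"
      by (rule lborel_pair.integrable_fst) (use int2 in \<open>simp only: case_prod_beta'\<close>)
    then show "complex_integrable lborel (\<lambda>x. indicator {a..b} x *\<^sub>R (CLBINT t. iexp (- (t * x)) * char M t))"
      by simp
  qed
  also have "\<dots> / (2 * pi) = (LBINT x. indicator {a..b} x *\<^sub>R inversion_density M x)"
    by (simp add: inversion_density_def)
  also have "\<dots> = integral {a..b} (inversion_density M)"
    using set_borel_integral_eq_integral(2)[OF borel_integrable_atLeastAtMost'[OF continuous_on_subset[OF continuous_inversion_density]], of a b]
    by (simp add: set_lebesgue_integral_def)
  finally show ?thesis .
qed

lemma continuity_point_between:
  assumes "a < b"
  obtains c where "a < c" "c < b" "measure M {c} = 0"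
proof -
  have "\<exists>c\<in>{a<..<b}. c \<notin> {x. measure M {x} \<noteq> 0}"
    using open_minus_countable[OF countable_support, of "{a<..<b}"] assms by auto
  then show ?thesis using that by auto
qed

text \<open>Inversion is so far restricted to end points without mass, but these are dense. An atom would thus
  lie in arbitrarily short intervals whose measure is at most the length times a bound for the
  density.\<close>
lemma no_atoms: "measure M {x} = 0"
proof -
  define C where "C = (LBINT t. cmod (char M t)) / (2 * pi)"
  have C: "\<bar>inversion_density M y\<bar> \<le> C" for y
    unfolding C_def by (rule inversion_density_le)
  have "measure M {x} \<le> 2 * C * e" if e: "0 < e" for e
  proof -
    obtain a where a: "x - e < a" "a < x" "measure M {a} = 0"
      by (rule continuity_point_between[of "x - e" x]) (use e in auto)
    obtain b where b: "x < b" "b < x + e" "measure M {b} = 0"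
      by (rule continuity_point_between[of x "x + e"]) (use e in auto)
    have "measure M {x} \<le> measure M {a<..b}"
      using a b by (intro finite_measure_mono) auto
    also have "\<dots> = integral {a..b} (inversion_density M)"
      using a b by (intro measure_Ioc_eq_integral_of_continuity_points) auto
    also have "\<dots> \<le> integral {a..b} (\<lambda>_. C)"
      using C by (intro integral_le integrable_continuous_real continuous_on_subset[OF continuous_inversion_density])
        (auto simp: abs_le_iff)
    also have "\<dots> = (b - a) * C" using a b by simp
    also have "\<dots> \<le> 2 * C * e"
    proof -
      have "0 \<le> C" using C[of 0] by linarith
      then have "(b - a) * C \<le> (2 * e) * C" using a b by (intro mult_right_mono) auto
      then show ?thesis by (simp add: mult_ac)
    qed
    finally show ?thesis .
  qed
  then have "eventually (\<lambda>e. measure M {x} \<le> 2 * C * e) (at_right 0)"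
    by (auto simp: eventually_at_filter intro: always_eventually)
  moreover have "((\<lambda>e. 2 * C * e) \<longlongrightarrow> 2 * C * 0) (at_right 0)"
    by (intro tendsto_intros)
  ultimately have "measure M {x} \<le> 2 * C * 0"
    by (intro tendsto_lowerbound) auto
  then show ?thesis by (simp add: measure_le_0_iff)
qed

lemma measure_Ioc_eq_integral:
  "a \<le> b \<Longrightarrow> measure M {a<..b} = integral {a..b} (inversion_density M)"
  by (rule measure_Ioc_eq_integral_of_continuity_points) (auto simp: no_atoms)

text \<open>A negative value would, by continuity, give an interval of negative measure.\<close>
lemma inversion_density_nonneg: "0 \<le> inversion_density M x"
proof (rule ccontr)
  assume "\<not> 0 \<le> inversion_density M x"
  then have "eventually (\<lambda>y. inversion_density M y < 0) (nhds x)"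
    using continuous_inversion_density
    by (intro order_tendstoD(2)[of "inversion_density M" "inversion_density M x"])
       (auto simp: continuous_on_eq_continuous_at isCont_def tendsto_at_iff_tendsto_nhds)
  then obtain e where e: "0 < e" "\<And>y. dist y x < e \<Longrightarrow> inversion_density M y < 0"
    by (auto simp: eventually_nhds_metric)
  let ?b = "x + e / 2"
  have "0 \<le> integral {x..?b} (inversion_density M)"
    using measure_Ioc_eq_integral[of x ?b] e(1) by (metis add_increasing2 half_gt_zero less_imp_le measure_nonneg le_add_same_cancel1)
  moreover have "integral {x..?b} (inversion_density M) < integral {x..?b} (\<lambda>_. 0)"
    using e by (intro integral_less_real continuous_on_subset[OF continuous_inversion_density] continuous_intros)
      (auto simp: dist_real_def)
  ultimately show False by simp
qed

text \<open>Both measures agree on the half-open intervals, which generate the Borel sets.\<close>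
theorem has_continuous_density_of_integrable_char: "has_continuous_density M"
proof -
  let ?f = "inversion_density M"
  have [measurable]: "?f \<in> borel_measurable borel"
    by (rule borel_measurable_continuous_onI[OF continuous_inversion_density])
  have Ioc: "emeasure (density lborel (\<lambda>x. ennreal (?f x))) {a<..b} = emeasure M {a<..b}" for a b
  proof (cases "a \<le> b")
    case True
    have "(?f has_integral measure M {a<..b}) {a..b}"
      unfolding measure_Ioc_eq_integral[OF True]
      by (intro integrable_integral integrable_continuous_real continuous_on_subset[OF continuous_inversion_density]) auto
    then have "((\<lambda>x. if x \<in> {a<..b} then ?f x else 0) has_integral measure M {a<..b}) UNIV"
      unfolding has_integral_restrict_UNIV
      by (subst has_integral_spike_set_eq[of _ "{a..b}"]) (auto intro: negligible_subset[of "{a}"])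
    also have "(\<lambda>x. if x \<in> {a<..b} then ?f x else 0) = (\<lambda>x. ?f x * indicator {a<..b} x)"
      by (auto split: split_indicator)
    finally have "(\<integral>\<^sup>+x. ennreal (?f x * indicator {a<..b} x) \<partial>lborel) = ennreal (measure M {a<..b})"
      by (intro nn_integral_has_integral_lborel) (auto simp: inversion_density_nonneg)
    then show ?thesis
      by (simp add: emeasure_density emeasure_eq_measure ennreal_mult' inversion_density_nonneg ennreal_indicator)
  qed simp
  have "M = density lborel (\<lambda>x. ennreal (?f x))"
  proof (rule measure_eqI_generator_eq[where \<Omega> = UNIV and E = "range (\<lambda>(a, b). {a<..b::real})" and A = "\<lambda>i. {- real i<..real i}"])
    show "(\<Union>i. {- real i<..real i}) = UNIV" by (rule UN_Ioc_eq_UNIV)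
  qed (auto simp: Ioc borel_sigma_sets_Ioc Int_stable_def M_is_borel emeasure_eq_measure)
  then show ?thesis
    unfolding has_continuous_density_def
    using continuous_inversion_density inversion_density_nonneg by blast
qed

end

end

section \<open>Integrability for almost every sequence of ratios\<close>

text \<open>The frequencies are cut into the shells \<open>A n\<close>, on which \<open>\<bar>\<xi>\<bar>\<close> is of order \<open>\<rho> ^ (- n)\<close>, and on each shell
  \<open>n\<close> cosine factors are used. The function \<open>H\<close> collects the guarded products over all shells; its
  integral has finite expectation, hence is finite almost surely. For a typical \<open>\<omega>\<close> the guards are
  all satisfied on every far shell, so there \<open>H\<close> dominates the characteristic function.\<close>
lemma AE_integrable_char_random_bernoulli_convolution:
  assumes "prob_space N" and id[measurable]: "(\<lambda>x. x) \<in> borel_measurable N"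
    and lu: "0 < l" "u < 1" "\<And>x. x \<in> space N \<Longrightarrow> x \<in> {l..u}"
    and \<rho>: "0 < \<rho>" "\<rho> < 1" "ln \<rho> < (\<integral>x. ln x \<partial>N)"
    and \<beta>: "0 \<le> \<beta>" "\<beta> < \<rho>" and y\<^sub>0: "0 < y\<^sub>0"
    and cos_le: "\<And>y. y\<^sub>0 \<le> y \<Longrightarrow> (\<integral>\<^sup>+x. ennreal \<bar>cos (y * x)\<bar> \<partial>N) \<le> ennreal \<beta>"
  shows "AE \<omega> in (\<Pi>\<^sub>M k\<in>(UNIV :: nat set). N).
    complex_integrable lborel (char (random_bernoulli_convolution \<omega>))"
proof -
  let ?S = "\<Pi>\<^sub>M k\<in>(UNIV :: nat set). N"
  interpret S: prob_space ?S by (intro prob_space_PiM assms)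
  interpret P: pair_sigma_finite lborel ?S ..
  define A where "A n = {\<xi>::real. y\<^sub>0 \<le> \<bar>\<xi>\<bar> / 2 * \<rho> ^ n \<and> \<bar>\<xi>\<bar> / 2 * \<rho> ^ Suc n \<le> y\<^sub>0}" for n
  define H where "H \<xi> \<omega> = (\<Sum>n. indicator (A n) \<xi> * guarded_cos_prod y\<^sub>0 n (\<bar>\<xi>\<bar> / 2) \<omega>)" for \<xi> \<omega>
  have [measurable]: "A n \<in> sets borel" for n unfolding A_def by measurable
  have gm[measurable]: "(\<lambda>p. guarded_cos_prod y\<^sub>0 n (\<bar>fst p\<bar> / 2) (snd p)) \<in> borel_measurable (lborel \<Otimes>\<^sub>M ?S)" for n
  proof -
    have "(\<lambda>p. (\<bar>fst p\<bar> / 2 :: real, snd p)) \<in> measurable (lborel \<Otimes>\<^sub>M ?S) (borel \<Otimes>\<^sub>M ?S)" by measurable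
    from measurable_compose[OF this measurable_guarded_cos_prod[OF id, of y\<^sub>0 n]] show ?thesis by simp
  qed
  have gm1[measurable]: "guarded_cos_prod y\<^sub>0 n y \<in> borel_measurable ?S" for n y
    using measurable_compose[OF _ measurable_guarded_cos_prod[OF id], of "\<lambda>\<omega>. (y, \<omega>)" ?S] by simp
  have Hm[measurable]: "(\<lambda>p. H (fst p) (snd p)) \<in> borel_measurable (lborel \<Otimes>\<^sub>M ?S)"
    unfolding H_def by measurable
  have A_le: "emeasure lborel (A n) \<le> ennreal (4 * y\<^sub>0 / \<rho> ^ Suc n)" for n
  proof -
    have "A n \<subseteq> {- (2 * y\<^sub>0 / \<rho> ^ Suc n)..2 * y\<^sub>0 / \<rho> ^ Suc n}"
    proof
      fix \<xi> assume "\<xi> \<in> A n"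
      then have "\<bar>\<xi>\<bar> \<le> 2 * y\<^sub>0 / \<rho> ^ Suc n"
        using \<rho> by (subst pos_le_divide_eq) (auto simp: A_def)
      then show "\<xi> \<in> {- (2 * y\<^sub>0 / \<rho> ^ Suc n)..2 * y\<^sub>0 / \<rho> ^ Suc n}"
        by (auto simp: abs_le_iff)
    qed
    then have "emeasure lborel (A n) \<le> emeasure lborel {- (2 * y\<^sub>0 / \<rho> ^ Suc n)..2 * y\<^sub>0 / \<rho> ^ Suc n}"
      by (intro emeasure_mono) auto
    also have "\<dots> = ennreal (4 * y\<^sub>0 / \<rho> ^ Suc n)"
      using y\<^sub>0 \<rho> by (subst emeasure_lborel_Icc) (auto intro: order_trans[of _ 0])
    finally show ?thesis .
  qed
  have "(\<integral>\<^sup>+\<omega>. (\<integral>\<^sup>+\<xi>. H \<xi> \<omega> \<partial>lborel) \<partial>?S) = (\<integral>\<^sup>+\<xi>. (\<integral>\<^sup>+\<omega>. H \<xi> \<omega> \<partial>?S) \<partial>lborel)"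
    by (rule P.Fubini') (use Hm in \<open>simp add: case_prod_beta'\<close>)
  also have "\<dots> = (\<integral>\<^sup>+\<xi>. (\<Sum>n. indicator (A n) \<xi> * (\<integral>\<^sup>+\<omega>. guarded_cos_prod y\<^sub>0 n (\<bar>\<xi>\<bar> / 2) \<omega> \<partial>?S)) \<partial>lborel)"
    unfolding H_def by (simp add: nn_integral_suminf nn_integral_cmult)
  also have "\<dots> \<le> (\<integral>\<^sup>+\<xi>. (\<Sum>n. indicator (A n) \<xi> * ennreal \<beta> ^ n) \<partial>lborel)"
    by (intro nn_integral_mono suminf_le mult_left_mono nn_integral_guarded_cos_prod_le assms) auto
  also have "\<dots> = (\<Sum>n. emeasure lborel (A n) * ennreal \<beta> ^ n)"
    by (subst nn_integral_suminf) (auto simp: nn_integral_multc)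
  also have "\<dots> \<le> (\<Sum>n. ennreal (4 * y\<^sub>0 / \<rho> * (\<beta> / \<rho>) ^ n))"
  proof (intro suminf_le)
    fix n
    have "emeasure lborel (A n) * ennreal \<beta> ^ n \<le> ennreal (4 * y\<^sub>0 / \<rho> ^ Suc n) * ennreal \<beta> ^ n"
      by (intro mult_right_mono A_le) auto
    also have "\<dots> = ennreal (4 * y\<^sub>0 / \<rho> * (\<beta> / \<rho>) ^ n)"
      using \<beta> \<rho> y\<^sub>0 by (simp add: ennreal_power power_divide flip: ennreal_mult)
    finally show "emeasure lborel (A n) * ennreal \<beta> ^ n \<le> ennreal (4 * y\<^sub>0 / \<rho> * (\<beta> / \<rho>) ^ n)" .
  qed auto
  also have "\<dots> < \<infinity>"
  proof -
    have "summable (\<lambda>n. 4 * y\<^sub>0 / \<rho> * (\<beta> / \<rho>) ^ n)"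
      using \<beta> \<rho> by (intro summable_mult summable_geometric) auto
    then show ?thesis
      using \<beta> \<rho> y\<^sub>0 by (subst suminf_ennreal2) auto
  qed
  finally have "AE \<omega> in ?S. (\<integral>\<^sup>+\<xi>. H \<xi> \<omega> \<partial>lborel) \<noteq> \<infinity>"
  \<comment> \<open>The measurability of the inner integral needs the two factors of the product space swapped.\<close>
  proof (intro nn_integral_noteq_infinite)
    have "(\<lambda>p. (snd p, fst p)) \<in> measurable (?S \<Otimes>\<^sub>M lborel) (lborel \<Otimes>\<^sub>M ?S)"
      by (intro measurable_Pair measurable_fst measurable_snd)
    from measurable_compose[OF this Hm]
    have "(\<lambda>p. H (snd p) (fst p)) \<in> borel_measurable (?S \<Otimes>\<^sub>M lborel)" by (simp only: fst_conv snd_conv)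
    then show "(\<lambda>\<omega>. \<integral>\<^sup>+\<xi>. H \<xi> \<omega> \<partial>lborel) \<in> borel_measurable ?S"
      by (intro lborel.borel_measurable_nn_integral) (simp only: case_prod_beta')
  qed simp
  moreover have "AE \<omega> in ?S. eventually (\<lambda>n. \<rho> ^ n \<le> contraction \<omega> n) sequentially"
    using lu(1,3) \<rho>(1,3) by (rule AE_eventually_power_le_contraction[OF assms(1,2)])
  ultimately show ?thesis
    using AE_space
  proof eventually_elim
    case (elim \<omega>)
    let ?\<mu> = "random_bernoulli_convolution \<omega>"
    interpret real_distribution ?\<mu> by (rule real_distribution_random_bernoulli_convolution)
    have \<omega>: "\<omega> k \<in> {l..u}" for k
      using elim(3) lu(3)[of "\<omega> k"] by (auto simp: space_PiM PiE_iff)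
    have \<omega>01: "0 < \<omega> k" "\<omega> k \<le> 1" for k using \<omega>[of k] lu by auto
    obtain n\<^sub>0 where n\<^sub>0: "\<And>n. n\<^sub>0 \<le> n \<Longrightarrow> \<rho> ^ n \<le> contraction \<omega> n"
      using elim(2) by (auto simp: eventually_sequentially)
    define R where "R = 2 * y\<^sub>0 / \<rho> ^ n\<^sub>0"
    \<comment> \<open>Beyond \<open>R\<close>, the inner edge of the shell \<open>n\<^sub>0\<close>, all guards hold; up to \<open>R\<close> the bound 1 suffices.\<close>
    have key: "ennreal (cmod (char ?\<mu> \<xi>)) \<le> indicator {-R..R} \<xi> + H \<xi> \<omega>" for \<xi>
    proof (cases "\<bar>\<xi>\<bar> \<le> R")
      case True
      then have "\<xi> \<in> {-R..R}" by auto
      then show ?thesis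
        using cmod_char_le_1[of \<xi>] by (auto intro!: add_increasing2 simp: ennreal_le_1)
    next
      case False
      then have far: "y\<^sub>0 < \<bar>\<xi>\<bar> / 2 * \<rho> ^ n\<^sub>0" using \<rho> by (simp add: R_def field_simps)
      \<comment> \<open>The first power that brings \<open>\<bar>\<xi>\<bar> / 2\<close> down to \<open>y\<^sub>0\<close> marks the outer boundary of the shell of \<open>\<xi>\<close>.\<close>
      define m where "m = (LEAST m. \<bar>\<xi>\<bar> / 2 * \<rho> ^ m \<le> y\<^sub>0)"
      have "\<exists>m. \<bar>\<xi>\<bar> / 2 * \<rho> ^ m \<le> y\<^sub>0"
      proof -
        have "(\<lambda>m. \<bar>\<xi>\<bar> / 2 * \<rho> ^ m) \<longlonglongrightarrow> \<bar>\<xi>\<bar> / 2 * 0"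
          using \<rho> by (intro tendsto_intros LIMSEQ_realpow_zero) auto
        then have "eventually (\<lambda>m. \<bar>\<xi>\<bar> / 2 * \<rho> ^ m < y\<^sub>0) sequentially"
          using y\<^sub>0 by (intro order_tendstoD(2)) auto
        then show ?thesis by (auto simp: eventually_sequentially intro: less_imp_le)
      qed
      then have m: "\<bar>\<xi>\<bar> / 2 * \<rho> ^ m \<le> y\<^sub>0" unfolding m_def by (rule LeastI_ex)
      have "n\<^sub>0 < m"
      proof (rule ccontr)
        assume "\<not> n\<^sub>0 < m"
        then have "\<rho> ^ n\<^sub>0 \<le> \<rho> ^ m" using \<rho> by (intro power_decreasing) auto
        then have "\<bar>\<xi>\<bar> / 2 * \<rho> ^ n\<^sub>0 \<le> \<bar>\<xi>\<bar> / 2 * \<rho> ^ m" by (intro mult_left_mono) auto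
        with m far show False by simp
      qed
      then obtain n where n: "m = Suc n" "n\<^sub>0 \<le> n" by (cases m) auto
      have "y\<^sub>0 < \<bar>\<xi>\<bar> / 2 * \<rho> ^ n"
        using not_less_Least[of n "\<lambda>m. \<bar>\<xi>\<bar> / 2 * \<rho> ^ m \<le> y\<^sub>0"] n by (simp add: m_def)
      then have "\<xi> \<in> A n" using m n by (simp add: A_def)
      have "ennreal (cmod (char ?\<mu> \<xi>)) \<le> ennreal (\<Prod>k<n. \<bar>cos (\<bar>\<xi>\<bar> / 2 * contraction \<omega> (Suc k))\<bar>)"
        by (intro ennreal_leI cmod_char_random_bernoulli_convolution_le[OF lu(1,2) \<omega>])
      also have "\<dots> = guarded_cos_prod y\<^sub>0 n (\<bar>\<xi>\<bar> / 2) \<omega>"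
        unfolding guarded_cos_prod_def
      proof (subst prod_ennreal[symmetric], simp, intro prod.cong refl)
        fix k assume "k \<in> {..<n}"
        then have "\<rho> ^ n \<le> contraction \<omega> k"
          using n\<^sub>0[OF n(2)] contraction_antimono[of \<omega> k n] \<omega>01 by force
        then have "\<bar>\<xi>\<bar> / 2 * \<rho> ^ n \<le> \<bar>\<xi>\<bar> / 2 * contraction \<omega> k"
          by (intro mult_left_mono) auto
        with \<open>y\<^sub>0 < \<bar>\<xi>\<bar> / 2 * \<rho> ^ n\<close>
        have "indicator {y\<^sub>0..} (\<bar>\<xi>\<bar> / 2 * contraction \<omega> k) = (1 :: ennreal)" by simp
        then show "ennreal \<bar>cos (\<bar>\<xi>\<bar> / 2 * contraction \<omega> (Suc k))\<bar> =
            indicator {y\<^sub>0..} (\<bar>\<xi>\<bar> / 2 * contraction \<omega> k) * ennreal \<bar>cos (\<bar>\<xi>\<bar> / 2 * contraction \<omega> (Suc k))\<bar>"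
          by simp
      qed
      also have "\<dots> = (\<Sum>i\<in>{n}. indicator (A i) \<xi> * guarded_cos_prod y\<^sub>0 i (\<bar>\<xi>\<bar> / 2) \<omega>)"
        using \<open>\<xi> \<in> A n\<close> by simp
      also have "\<dots> \<le> H \<xi> \<omega>"
        unfolding H_def by (intro sum_le_suminf) auto
      finally show ?thesis by (rule add_increasing[rotated]) simp
    qed
    have [measurable]: "(\<lambda>\<xi>. H \<xi> \<omega>) \<in> borel_measurable lborel"
      using measurable_compose[OF _ Hm, of "\<lambda>\<xi>. (\<xi>, \<omega>)" lborel] elim(3) by simp
    have "(\<integral>\<^sup>+\<xi>. ennreal (cmod (char ?\<mu> \<xi>)) \<partial>lborel) \<le> (\<integral>\<^sup>+\<xi>. indicator {-R..R} \<xi> + H \<xi> \<omega> \<partial>lborel)"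
      by (intro nn_integral_mono key)
    also have "\<dots> = emeasure lborel {-R..R} + (\<integral>\<^sup>+\<xi>. H \<xi> \<omega> \<partial>lborel)"
      by (subst nn_integral_add) auto
    also have "\<dots> < \<infinity>"
      using elim(1) by (simp add: emeasure_lborel_Icc_eq less_top)
    finally show ?case by (intro integrableI_bounded) auto
  qed
qed

section \<open>The support has interior\<close>

text \<open>The set is a continuous image of the product space of digit sequences, which is compact by
  Tychonoff's theorem; the coding map is continuous as a uniformly convergent series.\<close>
lemma compact_random_self_similar_set:
  assumes "0 < l" "u < 1" "\<And>k. \<omega> k \<in> {l..u}"
  shows "compact (random_self_similar_set \<omega>)"
proof -
  let ?D = "UNIV \<rightarrow>\<^sub>E {0, 1} :: (nat \<Rightarrow> real) set"
  have u: "0 < u" using assms(1) assms(3)[of 0] by auto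
  have "compactin (product_topology (\<lambda>_. euclidean) UNIV) ?D"
    by (subst compactin_PiE) (auto simp: compactin_euclidean_iff)
  then have "compact ?D"
    by (simp add: euclidean_product_topology compactin_euclidean_iff)
  moreover have "continuous_on ?D (coding_map \<omega>)"
  proof (rule uniform_limit_theorem)
    show "uniform_limit ?D (\<lambda>n a. \<Sum>j<n. a j * (\<Prod>k\<le>j. \<omega> k)) (coding_map \<omega>) sequentially"
      unfolding coding_map_def[abs_def]
    proof (rule Weierstrass_m_test)
      show "summable (\<lambda>j. u ^ Suc j)"
        using assms(2) u by (subst summable_Suc_iff) (auto intro: summable_geometric)
      fix j :: nat and a assume "a \<in> ?D"
      then have a: "a j \<in> {0, 1}" by (auto simp: PiE_iff)
      have \<omega>: "0 \<le> \<omega> k" "\<omega> k \<le> u" for k using assms(1) assms(3)[of k] by auto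
      have "0 \<le> (\<Prod>k\<le>j. \<omega> k)" "(\<Prod>k\<le>j. \<omega> k) \<le> u ^ Suc j"
        using \<omega> prod_mono[of "{..j}" \<omega> "\<lambda>_. u"] by (auto intro!: prod_nonneg)
      with a u show "norm (a j * (\<Prod>k\<le>j. \<omega> k)) \<le> u ^ Suc j" by auto
    qed
    show "\<forall>\<^sub>F n in sequentially. continuous_on ?D (\<lambda>a. \<Sum>j<n. a j * (\<Prod>k\<le>j. \<omega> k))"
      by (intro always_eventually allI continuous_intros continuous_on_subset[OF continuous_on_product_coordinates]) auto
  qed simp
  ultimately have "compact (coding_map \<omega> ` ?D)" by (rule compact_continuous_image[rotated])
  also have "coding_map \<omega> ` ?D = random_self_similar_set \<omega>"
    unfolding random_self_similar_set_def by (auto simp: PiE_iff)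
  finally show ?thesis .
qed

text \<open>The open set where the density is positive cannot leave the closed set \<open>\<Lambda>\<^sub>\<omega>\<close>: the part outside
  would be open, of measure zero for \<open>\<mu>\<^sub>\<omega>\<close>, and hence Lebesgue null, so it is empty.\<close>
lemma interior_random_self_similar_set_nonempty:
  assumes "0 < l" "u < 1" "\<And>k. \<omega> k \<in> {l..u}"
    and "has_continuous_density (random_bernoulli_convolution \<omega>)"
  shows "interior (random_self_similar_set \<omega>) \<noteq> {}"
proof -
  let ?\<mu> = "random_bernoulli_convolution \<omega>" and ?\<Lambda> = "random_self_similar_set \<omega>"
  interpret real_distribution ?\<mu> by (rule real_distribution_random_bernoulli_convolution)
  obtain f :: "real \<Rightarrow> real" where f: "continuous_on UNIV f" "\<And>x. 0 \<le> f x"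
    and \<mu>: "?\<mu> = density lborel (\<lambda>x. ennreal (f x))"
    using assms(4) unfolding has_continuous_density_def by blast
  have [measurable]: "f \<in> borel_measurable borel"
    by (rule borel_measurable_continuous_onI[OF f(1)])
  have closed: "closed ?\<Lambda>"
    using compact_random_self_similar_set[OF assms(1-3)] by (rule compact_imp_closed)
  let ?U = "{x. 0 < f x}"
  have "open ?U"
    using f(1) by (intro open_Collect_less) auto
  have "?U \<noteq> {}"
  proof
    assume "?U = {}"
    then have "f x = 0" for x using f(2)[of x] by (metis antisym_conv2 empty_iff mem_Collect_eq)
    then have "emeasure ?\<mu> UNIV = 0" unfolding \<mu> by (simp add: emeasure_density)
    then show False using emeasure_space_1 by simp
  qed
  have "emeasure ?\<mu> (- ?\<Lambda>) = 0"
  proof -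
    have "coding_map \<omega> -` (- ?\<Lambda>) \<inter> space bernoulli_measure = {}"
      by (auto simp: space_bernoulli_measure random_self_similar_set_def PiE_iff)
    then show ?thesis
      unfolding random_bernoulli_convolution_def
      using closed by (subst emeasure_distr) (auto simp: measurable_coding_map)
  qed
  moreover have "- ?\<Lambda> \<in> sets ?\<mu>"
    using closed by (simp add: M_is_borel)
  moreover have "?U - ?\<Lambda> \<subseteq> - ?\<Lambda>" by blast
  ultimately have null: "emeasure ?\<mu> (?U - ?\<Lambda>) = 0"
    by (metis emeasure_eq_0)
  have [measurable]: "?U - ?\<Lambda> \<in> sets borel"
    using closed \<open>open ?U\<close> by (intro borel_open open_Diff)
  have "AE x in lborel. ennreal (f x) * indicator (?U - ?\<Lambda>) x = 0"
    using null unfolding \<mu> by (simp add: emeasure_density nn_integral_0_iff_AE)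
  then have "AE x in lborel. x \<notin> ?U - ?\<Lambda>"
    by eventually_elim (auto split: split_indicator_asm)
  then have "?U - ?\<Lambda> \<in> null_sets lborel"
    by (subst (asm) AE_iff_null_sets[symmetric]) auto
  then have "negligible (?U - ?\<Lambda>)"
    by (simp add: negligible_iff_null_sets null_sets_completionI)
  moreover have "open (?U - ?\<Lambda>)" using \<open>open ?U\<close> closed by (rule open_Diff)
  ultimately have "?U \<subseteq> ?\<Lambda>"
    using open_not_negligible by blast
  then show ?thesis
    using \<open>open ?U\<close> \<open>?U \<noteq> {}\<close> interior_maximal by blast
qed

section \<open>Random Bernoulli convolutions above the threshold\<close>

theorem theorem2:
  fixes lmin lmax :: real
  assumes "0 < lmin" and "lmin < lmax" and "lmax < 1"
    and "geometric_mean_ratio lmin lmax > 2 / pi"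
  shows "(AE \<omega> in ratio_measure lmin lmax.
            absolutely_continuous lborel (random_bernoulli_convolution \<omega>) \<and>
            has_continuous_density (random_bernoulli_convolution \<omega>)) \<and>
         (AE \<omega> in ratio_measure lmin lmax. interior (random_self_similar_set \<omega>) \<noteq> {})"
proof -
  define N where "N = uniform_measure (restrict_space lborel {lmin..lmax}) {lmin..lmax}"
  have S: "ratio_measure lmin lmax = (\<Pi>\<^sub>M k\<in>(UNIV :: nat set). N)"
    unfolding ratio_measure_def N_def ..
  have N: "prob_space N"
  proof -
    have "emeasure (restrict_space lborel {lmin..lmax}) {lmin..lmax} = ennreal (lmax - lmin)"
      using assms by (subst emeasure_restrict_space) auto
    then show ?thesis
      unfolding N_def using assms by (intro prob_space_uniform_measure) auto
  qed
  interpret N: prob_space N by fact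
  have id[measurable]: "(\<lambda>x. x) \<in> borel_measurable N"
    unfolding N_def
    by (subst measurable_cong_sets[OF sets_uniform_measure refl]) (auto intro: measurable_restrict_space1)
  have space: "x \<in> {lmin..lmax}" if "x \<in> space N" for x
    using that by (simp add: N_def space_restrict_space)
  \<comment> \<open>The minimum with 1 ensures \<open>\<rho> < 1\<close>, so that the shells tend to infinity.\<close>
  define \<rho> where "\<rho> = (2 / pi + min 1 (geometric_mean_ratio lmin lmax)) / 2"
  define \<beta> where "\<beta> = (2 / pi + \<rho>) / 2"
  \<comment> \<open>From this scale on, the error term in the mean of the cosine is at most \<open>\<beta> - 2 / \<pi>\<close>.\<close>
  define y\<^sub>0 where "y\<^sub>0 = 4 / ((\<beta> - 2 / pi) * (lmax - lmin))"
  have "2 / pi < 1" using pi_gt3 by simp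
  then have \<rho>: "2 / pi < \<rho>" "\<rho> < 1" "\<rho> < geometric_mean_ratio lmin lmax"
    using assms(4) unfolding \<rho>_def by argo+
  have "0 < \<rho>" using \<rho>(1) by (rule order.strict_trans[rotated]) simp
  then have \<beta>: "2 / pi < \<beta>" "\<beta> < \<rho>" "0 \<le> \<beta>" "0 < \<rho>" using \<rho>(1) by (auto simp: \<beta>_def)
  have y\<^sub>0: "0 < y\<^sub>0" using \<beta> assms by (simp add: y\<^sub>0_def)
  have "geometric_mean_ratio lmin lmax = exp (\<integral>x. ln x \<partial>N)"
  proof -
    have "(\<integral>x. ln x \<partial>N) = (\<integral>x. ln x \<partial>distr (\<Pi>\<^sub>M k\<in>(UNIV :: nat set). N) N (\<lambda>\<omega>. \<omega> 0))"
      by (subst distr_PiM_component) (auto intro: N)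
    also have "\<dots> = (\<integral>\<omega>. ln (\<omega> 0) \<partial>(\<Pi>\<^sub>M k\<in>(UNIV :: nat set). N))"
      by (rule integral_distr) auto
    finally show ?thesis by (simp add: geometric_mean_ratio_def S)
  qed
  with \<rho>(3) have "ln \<rho> < (\<integral>x. ln x \<partial>N)"
    using \<beta>(4) by (metis exp_less_cancel_iff exp_ln)
  moreover have "(\<integral>\<^sup>+x. ennreal \<bar>cos (y * x)\<bar> \<partial>N) \<le> ennreal \<beta>" if "y\<^sub>0 \<le> y" for y
  proof -
    have "4 / (y * (lmax - lmin)) \<le> \<beta> - 2 / pi"
    proof -
      have "0 < (\<beta> - 2 / pi) * (lmax - lmin)" using \<beta>(1) assms by simp
      then have "4 \<le> y * ((\<beta> - 2 / pi) * (lmax - lmin))"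
        using that unfolding y\<^sub>0_def by (simp only: pos_divide_le_eq)
      moreover have "0 < y * (lmax - lmin)" using that y\<^sub>0 assms by simp
      ultimately show ?thesis by (simp only: pos_divide_le_eq mult_ac)
    qed
    then show ?thesis
      unfolding N_def using that y\<^sub>0 assms
      by (intro order_trans[OF mean_abs_cos_le] ennreal_leI) auto
  qed
  ultimately have "AE \<omega> in ratio_measure lmin lmax.
      complex_integrable lborel (char (random_bernoulli_convolution \<omega>))"
    unfolding S using assms(1,3) space \<rho> \<beta> y\<^sub>0
    by (intro AE_integrable_char_random_bernoulli_convolution[OF N id, where \<rho> = \<rho> and \<beta> = \<beta> and y\<^sub>0 = y\<^sub>0]) auto
  then have density: "AE \<omega> in ratio_measure lmin lmax. has_continuous_density (random_bernoulli_convolution \<omega>)"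
    by eventually_elim
       (rule real_distribution.has_continuous_density_of_integrable_char[OF real_distribution_random_bernoulli_convolution])
  then have "AE \<omega> in ratio_measure lmin lmax.
      absolutely_continuous lborel (random_bernoulli_convolution \<omega>) \<and>
      has_continuous_density (random_bernoulli_convolution \<omega>)"
  proof eventually_elim
    case (elim \<omega>)
    then obtain f where "continuous_on UNIV f" "random_bernoulli_convolution \<omega> = density lborel (\<lambda>x. ennreal (f x))"
      unfolding has_continuous_density_def by blast
    then show ?case
      using elim by (auto intro!: absolutely_continuousI_density borel_measurable_continuous_onI continuous_on_ennreal)
  qed
  moreover have "AE \<omega> in ratio_measure lmin lmax. interior (random_self_similar_set \<omega>) \<noteq> {}"
    using density AE_space
  proof eventually_elim
    case (elim \<omega>)
    then have "\<omega> k \<in> {lmin..lmax}" for k by (auto simp: space_ratio_measure PiE_iff)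
    then show ?case
      using elim assms by (intro interior_random_self_similar_set_nonempty[of lmin lmax]) auto
  qed
  ultimately show ?thesis ..
qed

end
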